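(* Let $m(\mathbf n)$ and $w(\mathbf n)$, $\mathbf n=(n_1,n_2)$, be the fraction of men and the fraction of women, respectively, with more than one stable partner, for $n_1$ men and $n_2>n_1$ women with independent uniformly random preferences. Let $\gamma<1$. If $n_2-n_1\ge n_1^{1/2}(\log n_1)^{-\gamma}$, then, as $n_1\to\infty$, $\lim m(\mathbf n)=\lim w(\mathbf n)=0$ in probability.
   Context: There are $n_1$ men (the set $[n_1]$) and $n_2$ women (the set $[n_2]$), $n_1<n_2$. Each man strictly ranks all $n_2$ women and each woman strictly ranks all $n_1$ men; the $n_1+n_2$ rankings are independent, each a uniformly random permutation. A matching is an injection $\mathcal M:[n_1]\to[n_2]$. It is stable if there is no pair $(m,w)$, $m\in[n_1]$, $w\in[n_2]$, not matched to each other in $\mathcal M$, such that $m$ prefers $w$ to his partner $\mathcal M(m)$ and, if $w$ is matched in $\mathcal M$, $w$ prefers $m$ to her partner in $\mathcal M$ (an unmatched $w$ imposes no further condition). A stable partner of a person is anyone matched to that person in at least one stable matching. *)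

theory Defs
  imports "HOL-Probability.Probability" "HOL-Probability.Product_PMF" "HOL-Combinatorics.Permutations"
begin

text \<open>
  A profile is a pair \<open>(mp, wp)\<close>: \<open>mp m w\<close> is the rank that man \<open>m\<close> gives to woman \<open>w\<close>, and
  \<open>wp w m\<close> the rank that woman \<open>w\<close> gives to man \<open>m\<close>. Smaller ranks are better.
\<close>

type_synonym profile = "(nat \<Rightarrow> nat \<Rightarrow> nat) \<times> (nat \<Rightarrow> nat \<Rightarrow> nat)"

text \<open>
  The default value \<open>id\<close> of \<open>Pi_pmf\<close> is only used for persons outside the market.
\<close>

definition random_profile :: "nat \<Rightarrow> nat \<Rightarrow> profile pmf" where
  "random_profile n1 n2 =
     pair_pmf (Pi_pmf {1..n1} id (\<lambda>_. pmf_of_set {p. p permutes {1..n2}}))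
              (Pi_pmf {1..n2} id (\<lambda>_. pmf_of_set {p. p permutes {1..n1}}))"

definition matching :: "nat \<Rightarrow> nat \<Rightarrow> (nat \<Rightarrow> nat) \<Rightarrow> bool" where
  "matching n1 n2 M \<longleftrightarrow> M \<in> {1..n1} \<rightarrow> {1..n2} \<and> inj_on M {1..n1}"

text \<open>
  In a blocking pair, the condition on \<open>w\<close> is vacuous if \<open>w\<close> is unmatched.
\<close>

definition blocking_pair ::
    "nat \<Rightarrow> nat \<Rightarrow> profile \<Rightarrow> (nat \<Rightarrow> nat) \<Rightarrow> nat \<Rightarrow> nat \<Rightarrow> bool" where
  "blocking_pair n1 n2 P M m w \<longleftrightarrow>
     m \<in> {1..n1} \<and> w \<in> {1..n2} \<and> M m \<noteq> w \<and>
     fst P m w < fst P m (M m) \<and>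
     (\<forall>m'\<in>{1..n1}. M m' = w \<longrightarrow> snd P w m < snd P w m')"

definition stable :: "nat \<Rightarrow> nat \<Rightarrow> profile \<Rightarrow> (nat \<Rightarrow> nat) \<Rightarrow> bool" where
  "stable n1 n2 P M \<longleftrightarrow> matching n1 n2 M \<and> (\<nexists>m w. blocking_pair n1 n2 P M m w)"

definition stable_wives :: "nat \<Rightarrow> nat \<Rightarrow> profile \<Rightarrow> nat \<Rightarrow> nat set" where
  "stable_wives n1 n2 P m = {w \<in> {1..n2}. \<exists>M. stable n1 n2 P M \<and> M m = w}"

definition stable_husbands :: "nat \<Rightarrow> nat \<Rightarrow> profile \<Rightarrow> nat \<Rightarrow> nat set" where
  "stable_husbands n1 n2 P w = {m \<in> {1..n1}. \<exists>M. stable n1 n2 P M \<and> M m = w}"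

definition men_fraction :: "nat \<Rightarrow> nat \<Rightarrow> profile \<Rightarrow> real" where
  "men_fraction n1 n2 P =
     real (card {m \<in> {1..n1}. card (stable_wives n1 n2 P m) > 1}) / real n1"

definition women_fraction :: "nat \<Rightarrow> nat \<Rightarrow> profile \<Rightarrow> real" where
  "women_fraction n1 n2 P =
     real (card {w \<in> {1..n2}. card (stable_husbands n1 n2 P w) > 1}) / real n2"

text \<open>
  Convergence in probability to a constant. The random variables \<open>X i\<close> may live on different
  probability spaces.
\<close>

definition tendsto_in_prob ::
    "('i \<Rightarrow> 'a pmf) \<Rightarrow> ('i \<Rightarrow> 'a \<Rightarrow> real) \<Rightarrow> real \<Rightarrow> 'i filter \<Rightarrow> bool" where
  "tendsto_in_prob p X c F \<longleftrightarrow>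
     (\<forall>\<epsilon>>0. ((\<lambda>i. measure_pmf.prob (p i) {x. \<bar>X i x - c\<bar> > \<epsilon>}) \<longlongrightarrow> 0) F)"

text \<open>
  The limit \<open>n1 \<rightarrow> \<infinity>\<close> along pairs \<open>(n1, n2) \<in> A\<close>, uniformly in \<open>n2\<close>.
\<close>

definition fst_at_top_within :: "(nat \<times> nat) set \<Rightarrow> (nat \<times> nat) filter" where
  "fst_at_top_within A = inf (filtercomap fst at_top) (principal A)"

lemma eventually_fst_at_top_within:
  "eventually Q (fst_at_top_within A) \<longleftrightarrow>
     (\<exists>N. \<forall>n1\<ge>N. \<forall>n2. (n1, n2) \<in> A \<longrightarrow> Q (n1, n2))"
  unfolding fst_at_top_within_def eventually_inf_principal eventually_filtercomap
    eventually_at_top_linorder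
  by (metis fst_conv prod.collapse)

end

theory Submission
  imports Defs "HOL-Real_Asymp.Real_Asymp"
begin

text \<open>
  Let \<open>k = n2 - n1\<close>. A woman \<open>w\<close> has more than one stable husband only if, after the man-proposing
  algorithm stops and \<open>w\<close> dismisses her partner, the resumed algorithm sends a man to \<open>w\<close> before
  any man reaches one of the \<open>k\<close> unmatched women. Below their current partners, the lists of the
  men are still exchangeable, so each of these \<open>k + 1\<close> women is equally likely to be reached first.
  Hence \<open>w\<close> has more than one stable husband with probability at most \<open>1 / (k + 1)\<close>. As many men as
  women have more than one stable partner, and \<open>k\<close> tends to infinity, so Markov's inequality
  finishes the proof.
\<close>

subsection \<open>Deferred acceptance\<close>

text \<open>The default \<open>id\<close> for persons outside the market agrees with that of
  \<open>random_profile\<close>, so this is exactly its support.\<close>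

definition profiles :: "nat \<Rightarrow> nat \<Rightarrow> profile set" where
  "profiles n1 n2 = PiE_dflt {1..n1} id (\<lambda>_. {p. p permutes {1..n2}}) \<times>
                    PiE_dflt {1..n2} id (\<lambda>_. {p. p permutes {1..n1}})"

text \<open>
  The pairs in \<open>X\<close> are excluded from the outset, and the women in \<open>T\<close> reject nobody. The first
  premise of \<open>suitor\<close> says that \<open>a\<close> gets as far as proposing to \<open>v\<close>.
\<close>

inductive rejected :: "nat \<Rightarrow> nat \<Rightarrow> profile \<Rightarrow> (nat \<times> nat) set \<Rightarrow> nat set \<Rightarrow> nat \<Rightarrow> nat \<Rightarrow> bool"
  for n1 n2 P X T where
  excluded: "(m, v) \<in> X \<Longrightarrow> rejected n1 n2 P X T m v"
| suitor: "(\<And>v'. v' \<in> {1..n2} \<Longrightarrow> fst P a v' < fst P a v \<Longrightarrow> rejected n1 n2 P X T a v') \<Longrightarrow>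
    a \<in> {1..n1} \<Longrightarrow> v \<in> {1..n2} \<Longrightarrow> v \<notin> T \<Longrightarrow> snd P v a < snd P v m \<Longrightarrow> rejected n1 n2 P X T m v"

definition assigned ::
    "nat \<Rightarrow> nat \<Rightarrow> profile \<Rightarrow> (nat \<times> nat) set \<Rightarrow> nat set \<Rightarrow> nat \<Rightarrow> nat" where
  "assigned n1 n2 P X T m = arg_min (fst P m) (\<lambda>v. v \<in> {1..n2} \<and> \<not> rejected n1 n2 P X T m v)"

text \<open>With nothing excluded this is the man-proposing algorithm, whose outcome is the
  man-optimal stable matching.\<close>

definition opt :: "nat \<Rightarrow> nat \<Rightarrow> profile \<Rightarrow> nat \<Rightarrow> nat" where
  "opt n1 n2 P = assigned n1 n2 P {} {}"

definition targets :: "nat \<Rightarrow> nat \<Rightarrow> nat \<Rightarrow> profile \<Rightarrow> nat set" where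
  "targets n1 n2 w P = insert w ({1..n2} - opt n1 n2 P ` {1..n1})"

text \<open>A man proposes down his list as far as \<open>opt\<close>, so these are the men who
  propose to \<open>w\<close> in the first run, her dismissed partner included.\<close>

definition suitors :: "nat \<Rightarrow> nat \<Rightarrow> nat \<Rightarrow> profile \<Rightarrow> (nat \<times> nat) set" where
  "suitors n1 n2 w P = {m \<in> {1..n1}. fst P m w \<le> fst P m (opt n1 n2 P m)} \<times> {w}"

text \<open>
  During the restart \<open>w\<close> accepts anyone except the men who have already proposed to her; letting
  her accept more men than she would only weakens the condition to be tested and makes her
  interchangeable with the unmatched women.
\<close>

definition restart :: "nat \<Rightarrow> nat \<Rightarrow> nat \<Rightarrow> profile \<Rightarrow> nat \<Rightarrow> nat" where
  "restart n1 n2 w P = assigned n1 n2 P (suitors n1 n2 w P) (targets n1 n2 w P)"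

text \<open>
  Only men who have not yet proposed to \<open>w\<close> exchange \<open>w\<close> and \<open>t\<close>. This leaves the first run of the
  algorithm unchanged and makes \<open>redirect n1 n2 w t\<close> an involution.
\<close>

definition exch :: "nat \<Rightarrow> nat \<Rightarrow> nat \<Rightarrow> nat \<Rightarrow> profile \<Rightarrow> nat \<Rightarrow> nat \<Rightarrow> nat" where
  "exch n1 n2 w t P m =
     (if m \<in> {1..n1} \<and> fst P m (opt n1 n2 P m) < fst P m w then Transposition.transpose w t else id)"

definition redirect :: "nat \<Rightarrow> nat \<Rightarrow> nat \<Rightarrow> nat \<Rightarrow> profile \<Rightarrow> profile" where
  "redirect n1 n2 w t P = ((\<lambda>m. fst P m \<circ> exch n1 n2 w t P m), snd P)"

definition several_husbands :: "nat \<Rightarrow> nat \<Rightarrow> nat \<Rightarrow> profile set" where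
  "several_husbands n1 n2 w = {P \<in> profiles n1 n2. card (stable_husbands n1 n2 P w) > 1}"

section \<open>The man-proposing algorithm and its outcome\<close>

locale market =
  fixes n1 n2 :: nat and P :: profile
  assumes profile: "P \<in> profiles n1 n2" and less: "n1 < n2"
begin

lemma inj_men: "m \<in> {1..n1} \<Longrightarrow> inj (fst P m)"
  using profile by (auto simp: profiles_def PiE_dflt_def permutes_inj)

lemma inj_women: "w \<in> {1..n2} \<Longrightarrow> inj (snd P w)"
  using profile by (auto simp: profiles_def PiE_dflt_def permutes_inj)

lemma assigned_eqI:
  assumes "m \<in> {1..n1}" "v \<in> {1..n2}" "\<not> rejected n1 n2 P X T m v"
    and "\<And>v'. v' \<in> {1..n2} \<Longrightarrow> fst P m v' < fst P m v \<Longrightarrow> rejected n1 n2 P X T m v'"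
  shows "assigned n1 n2 P X T m = v"
proof -
  let ?Q = "\<lambda>v. v \<in> {1..n2} \<and> \<not> rejected n1 n2 P X T m v"
  have "?Q (assigned n1 n2 P X T m)" "fst P m (assigned n1 n2 P X T m) \<le> fst P m v"
    unfolding assigned_def using arg_min_nat_lemma[of ?Q v "fst P m"] assms by auto
  then have "fst P m (assigned n1 n2 P X T m) = fst P m v"
    using assms(4) by (meson le_neq_implies_less)
  then show ?thesis
    using inj_men[OF assms(1)] by (simp add: inj_eq)
qed

lemma
  assumes "\<exists>v\<in>{1..n2}. \<not> rejected n1 n2 P X T m v"
  shows assigned_in: "assigned n1 n2 P X T m \<in> {1..n2}"
    and assigned_not_rejected: "\<not> rejected n1 n2 P X T m (assigned n1 n2 P X T m)"
    and assigned_le: "v \<in> {1..n2} \<Longrightarrow> \<not> rejected n1 n2 P X T m v \<Longrightarrow>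
      fst P m (assigned n1 n2 P X T m) \<le> fst P m v"
proof -
  let ?Q = "\<lambda>v. v \<in> {1..n2} \<and> \<not> rejected n1 n2 P X T m v"
  obtain v0 where "?Q v0" using assms by blast
  note * = arg_min_nat_lemma[of ?Q, OF this, of "fst P m", folded assigned_def]
  show "assigned n1 n2 P X T m \<in> {1..n2}" "\<not> rejected n1 n2 P X T m (assigned n1 n2 P X T m)"
    "v \<in> {1..n2} \<Longrightarrow> \<not> rejected n1 n2 P X T m v \<Longrightarrow>
      fst P m (assigned n1 n2 P X T m) \<le> fst P m v"
    using * by auto
qed

lemma assigned_better_rejected:
  assumes "\<exists>v\<in>{1..n2}. \<not> rejected n1 n2 P X T m v" "v \<in> {1..n2}"
    and "fst P m v < fst P m (assigned n1 n2 P X T m)"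
  shows "rejected n1 n2 P X T m v"
  using assigned_le[OF assms(1,2)] assms(3) by (meson not_less)

text \<open>Of two men assigned to \<open>v\<close>, the one she likes less is rejected, because the
  other gets as far as proposing to her. Only women in \<open>T\<close> can hold several
  men.\<close>

lemma assigned_inj:
  assumes "m \<in> {1..n1}" "m' \<in> {1..n1}"
    and ex: "\<exists>v\<in>{1..n2}. \<not> rejected n1 n2 P X T m v" "\<exists>v\<in>{1..n2}. \<not> rejected n1 n2 P X T m' v"
    and eq: "assigned n1 n2 P X T m = v" "assigned n1 n2 P X T m' = v" and "v \<notin> T"
  shows "m = m'"
proof (rule ccontr)
  assume ne: "m \<noteq> m'"
  have v: "v \<in> {1..n2}"
    using assigned_in[OF ex(1)] eq by simp
  have ne': "snd P v m \<noteq> snd P v m'"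
    using inj_women[OF v] ne by (simp add: inj_eq)
  have no_pref: "\<not> snd P v a < snd P v b"
    if "a \<in> {1..n1}" "assigned n1 n2 P X T a = v" "assigned n1 n2 P X T b = v"
      and exa: "\<exists>v\<in>{1..n2}. \<not> rejected n1 n2 P X T a v"
      and exb: "\<exists>v\<in>{1..n2}. \<not> rejected n1 n2 P X T b v" for a b
  proof
    assume "snd P v a < snd P v b"
    then have "rejected n1 n2 P X T b v"
      using assigned_better_rejected[OF exa] that(1,2) v \<open>v \<notin> T\<close>
      by (intro suitor[of n2 P a v n1 X T b]) simp_all
    then show False using assigned_not_rejected[OF exb] that(3) by simp
  qed
  show False
    using ne' no_pref[OF assms(1) eq ex] no_pref[OF assms(2) eq(2,1) ex(2,1)] by linarith
qed

text \<open>The favourite of \<open>v\<close> among the men who get as far as proposing to her is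
  never rejected by her, so he stays.\<close>

lemma best_suitor:
  assumes "m \<in> {1..n1}" "v \<in> {1..n2}"
    and "\<And>v'. v' \<in> {1..n2} \<Longrightarrow> fst P m v' < fst P m v \<Longrightarrow> rejected n1 n2 P {} {} m v'"
  shows "\<exists>b\<in>{1..n1}. opt n1 n2 P b = v \<and> snd P v b \<le> snd P v m"
proof -
  let ?Q = "\<lambda>a. a \<in> {1..n1} \<and>
    (\<forall>v'. v' \<in> {1..n2} \<longrightarrow> fst P a v' < fst P a v \<longrightarrow> rejected n1 n2 P {} {} a v')"
  have m: "?Q m" using assms by blast
  obtain b where b: "?Q b" and min: "\<And>a. ?Q a \<Longrightarrow> snd P v b \<le> snd P v a"
    using ex_has_least_nat[of ?Q, OF m, of "snd P v"] by blast
  have "\<not> rejected n1 n2 P {} {} b v"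
  proof
    assume "rejected n1 n2 P {} {} b v"
    then obtain a where "?Q a" "snd P v a < snd P v b"
      by cases auto
    then show False using min[of a] by simp
  qed
  then have "opt n1 n2 P b = v"
    unfolding opt_def using b assms(2) by (intro assigned_eqI) auto
  then show ?thesis using b min[OF m] by blast
qed

text \<open>A man rejected by everybody would be outranked by \<open>n2 > n1\<close> different men.\<close>

lemma ex_unrejected:
  assumes "m \<in> {1..n1}"
  shows "\<exists>v\<in>{1..n2}. \<not> rejected n1 n2 P {} {} m v"
proof (rule ccontr)
  assume "\<not> ?thesis"
  then have "\<exists>b\<in>{1..n1}. opt n1 n2 P b = v" if "v \<in> {1..n2}" for v
    using best_suitor[OF assms that] by blast
  then have "{1..n2} \<subseteq> opt n1 n2 P ` {1..n1}" by blast
  then have "n2 \<le> card (opt n1 n2 P ` {1..n1})"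
    using card_mono[of "opt n1 n2 P ` {1..n1}" "{1..n2}"] by simp
  also have "\<dots> \<le> n1"
    using card_image_le[of "{1..n1}" "opt n1 n2 P"] by simp
  finally show False using less by simp
qed

lemmas opt_in = assigned_in[OF ex_unrejected, folded opt_def]
lemmas opt_not_rejected = assigned_not_rejected[OF ex_unrejected, folded opt_def]
lemmas opt_le = assigned_le[OF ex_unrejected, folded opt_def]
lemmas opt_better_rejected = assigned_better_rejected[OF ex_unrejected, folded opt_def]

lemma inj_on_opt: "inj_on (opt n1 n2 P) {1..n1}"
  using assigned_inj[OF _ _ ex_unrejected ex_unrejected] unfolding opt_def inj_on_def by blast

text \<open>If \<open>m\<close> prefers \<open>w\<close> to his partner, she rejected him for a
  suitor, and by \<open>best_suitor\<close> she ends up with a man at least as good as that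
  suitor.\<close>

lemma opt_stable: "stable n1 n2 P (opt n1 n2 P)"
  unfolding stable_def matching_def
proof (intro conjI notI)
  show "opt n1 n2 P \<in> {1..n1} \<rightarrow> {1..n2}" using opt_in by blast
  show "inj_on (opt n1 n2 P) {1..n1}" by (rule inj_on_opt)
next
  assume "\<exists>m w. blocking_pair n1 n2 P (opt n1 n2 P) m w"
  then obtain m w where mw: "m \<in> {1..n1}" "w \<in> {1..n2}" "fst P m w < fst P m (opt n1 n2 P m)"
    and pref: "\<And>m'. m' \<in> {1..n1} \<Longrightarrow> opt n1 n2 P m' = w \<Longrightarrow> snd P w m < snd P w m'"
    unfolding blocking_pair_def by blast
  have "rejected n1 n2 P {} {} m w"
    using opt_better_rejected mw by blast
  then obtain a where a: "a \<in> {1..n1}" "snd P w a < snd P w m"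
    and "\<And>v'. v' \<in> {1..n2} \<Longrightarrow> fst P a v' < fst P a w \<Longrightarrow> rejected n1 n2 P {} {} a v'"
    by cases auto
  then obtain b where "b \<in> {1..n1}" "opt n1 n2 P b = w" "snd P w b \<le> snd P w a"
    using best_suitor[OF a(1) mw(2)] by blast
  then show False using pref a(2) by fastforce
qed

section \<open>Stable matchings compared with the man-optimal one\<close>

lemma stable_in: "stable n1 n2 P M \<Longrightarrow> m \<in> {1..n1} \<Longrightarrow> M m \<in> {1..n2}"
  unfolding stable_def matching_def by blast

lemma stable_inj: "stable n1 n2 P M \<Longrightarrow> inj_on M {1..n1}"
  unfolding stable_def matching_def by blast

text \<open>Induction on rejections. If \<open>v\<close> rejects her partner \<open>m\<close> for
  \<open>a\<close>, then all women whom \<open>a\<close> prefers to \<open>v\<close> have rejected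
  him, so by induction none of them is his partner in \<open>M\<close>. Hence \<open>a\<close>
  prefers \<open>v\<close> to \<open>M a\<close>, and the two block \<open>M\<close>.\<close>

lemma stable_not_rejected:
  assumes "stable n1 n2 P M" "\<And>m. m \<in> {1..n1} \<Longrightarrow> (m, M m) \<notin> X"
    and "rejected n1 n2 P X T m v" "m \<in> {1..n1}"
  shows "M m \<noteq> v"
  using assms(3,4)
proof (induction rule: rejected.induct)
  case (excluded m v)
  then show ?case using assms(2) by blast
next
  case (suitor a v m)
  show ?case
  proof
    assume v: "M m = v"
    have "a \<noteq> m" using suitor by blast
    then have ne: "M a \<noteq> v"
      using v stable_inj[OF assms(1)] suitor by (auto dest: inj_onD)
    have "\<not> fst P a (M a) < fst P a v"
      using suitor.IH[of "M a"] stable_in[OF assms(1)] suitor.hyps by blast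
    moreover have "fst P a (M a) \<noteq> fst P a v"
      using ne inj_men[OF suitor.hyps(2)] by (simp add: inj_eq)
    ultimately have "fst P a v < fst P a (M a)" by linarith
    moreover have "\<forall>m'\<in>{1..n1}. M m' = v \<longrightarrow> snd P v a < snd P v m'"
      using v stable_inj[OF assms(1)] suitor by (auto dest: inj_onD)
    ultimately have "blocking_pair n1 n2 P M a v"
      using suitor.hyps ne unfolding blocking_pair_def by blast
    then show False using assms(1) unfolding stable_def by blast
  qed
qed

lemma opt_best:
  assumes "stable n1 n2 P M" "m \<in> {1..n1}"
  shows "fst P m (opt n1 n2 P m) \<le> fst P m (M m)"
  using stable_not_rejected[OF assms(1), of "{}" "{}" m "M m"] assms
  by (intro opt_le stable_in) auto

lemma unmatched_worse:
  assumes "stable n1 n2 P M" "m \<in> {1..n1}" "w \<in> {1..n2}" "w \<notin> M ` {1..n1}"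
  shows "fst P m (M m) < fst P m w"
proof (rule ccontr)
  assume "\<not> ?thesis"
  moreover have "M m \<noteq> w" using assms by blast
  moreover have "fst P m (M m) \<noteq> fst P m w"
    using \<open>M m \<noteq> w\<close> inj_men[OF assms(2)] by (simp add: inj_eq)
  ultimately have "blocking_pair n1 n2 P M m w"
    using assms unfolding blocking_pair_def by auto
  then show False using assms(1) unfolding stable_def by blast
qed

text \<open>The rural hospitals theorem.\<close>

lemma matched_women_unique:
  assumes "stable n1 n2 P M"
  shows "M ` {1..n1} = opt n1 n2 P ` {1..n1}"
proof (rule sym, rule card_subset_eq)
  \<comment> \<open>Both images have \<open>n1\<close> elements, so one inclusion suffices. If
    \<open>M\<close> left a woman matched by \<open>opt\<close> unmatched, her partner under
    \<open>opt\<close> would be better off in \<open>M\<close>, against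
    \<open>opt_best\<close>.\<close>
  show "opt n1 n2 P ` {1..n1} \<subseteq> M ` {1..n1}"
  proof (rule image_subsetI, rule ccontr)
    fix m assume "m \<in> {1..n1}" "opt n1 n2 P m \<notin> M ` {1..n1}"
    then show False
      using unmatched_worse[OF assms _ opt_in] opt_best[OF assms] by (meson not_less)
  qed
  show "card (opt n1 n2 P ` {1..n1}) = card (M ` {1..n1})"
    using inj_on_opt stable_inj[OF assms] by (simp add: card_image)
qed simp

subsection \<open>Restarting with one woman dismissing her partner\<close>

lemma targets_subset: "w \<in> {1..n2} \<Longrightarrow> targets n1 n2 w P \<subseteq> {1..n2}"
  unfolding targets_def by auto

text \<open>The \<open>+ 1\<close> counts \<open>w\<close>, who is matched and so not among the
  unmatched women.\<close>

lemma card_targets: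
  assumes "w \<in> opt n1 n2 P ` {1..n1}"
  shows "card (targets n1 n2 w P) = n2 - n1 + 1"
proof -
  have "opt n1 n2 P ` {1..n1} \<subseteq> {1..n2}"
    using opt_in by blast
  then have "card ({1..n2} - opt n1 n2 P ` {1..n1}) = n2 - n1"
    using card_image[OF inj_on_opt] by (simp add: card_Diff_subset)
  then show ?thesis using assms unfolding targets_def by simp
qed

text \<open>Stability of \<open>opt\<close> puts every unmatched woman below the partner of
  \<open>m\<close>. For a man who has not reached \<open>w\<close>, all targets thus lie in the
  unexplored part of his list.\<close>

lemma target_worse:
  assumes "m \<in> {1..n1}" "t \<in> targets n1 n2 w P" "fst P m (opt n1 n2 P m) < fst P m w"
  shows "fst P m (opt n1 n2 P m) < fst P m t"
  using assms unmatched_worse[OF opt_stable] unfolding targets_def by blast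

text \<open>Some woman is unmatched under \<open>opt\<close>; as a target she rejects nobody, and
  the only woman with excluded pairs is \<open>w\<close>.\<close>

lemma restart_ex_unrejected:
  assumes "w \<in> opt n1 n2 P ` {1..n1}"
  shows "\<exists>v\<in>{1..n2}. \<not> rejected n1 n2 P (suitors n1 n2 w P) (targets n1 n2 w P) m v"
proof -
  have "card (opt n1 n2 P ` {1..n1}) < card {1..n2}"
    using less inj_on_opt by (simp add: card_image)
  then obtain u where "u \<in> {1..n2}" "u \<notin> opt n1 n2 P ` {1..n1}"
    by (metis card_mono finite_atLeastAtMost finite_imageI not_less subsetI)
  moreover from this have "\<not> rejected n1 n2 P (suitors n1 n2 w P) (targets n1 n2 w P) m u"
    using assms by (auto elim!: rejected.cases simp: suitors_def targets_def)
  ultimately show ?thesis by blast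
qed

lemmas restart_in = assigned_in[OF restart_ex_unrejected, folded restart_def]

text \<open>Otherwise the assignment would embed the \<open>n1\<close> men into the
  \<open>n1 - 1\<close> women who are not targets.\<close>

lemma restart_reaches_target:
  assumes "w \<in> opt n1 n2 P ` {1..n1}"
  shows "\<exists>a\<in>{1..n1}. restart n1 n2 w P a \<in> targets n1 n2 w P"
proof (rule ccontr)
  assume neg: "\<not> ?thesis"
  have w: "w \<in> {1..n2}" using assms opt_in by blast
  have "inj_on (restart n1 n2 w P) {1..n1}"
    using assigned_inj[OF _ _ restart_ex_unrejected[OF assms] restart_ex_unrejected[OF assms]] neg
    unfolding inj_on_def restart_def by metis
  moreover have "restart n1 n2 w P ` {1..n1} \<subseteq> {1..n2} - targets n1 n2 w P"
    using restart_in[OF assms] neg by blast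
  ultimately have "n1 \<le> card ({1..n2} - targets n1 n2 w P)"
    using card_inj_on_le[of "restart n1 n2 w P" "{1..n1}"] by simp
  also have "\<dots> = n2 - (n2 - n1 + 1)"
    using card_targets[OF assms] targets_subset[OF w]
    by (subst card_Diff_subset) (auto intro: finite_subset)
  \<comment> \<open>For \<open>n1 = 0\<close> truncated subtraction gives no contradiction; that
    case is ruled out because \<open>w\<close> is matched.\<close>
  finally show False
    using less assms by (cases n1) auto
qed

text \<open>\<open>opt\<close> is injective and so accounts for only one of two stable
  husbands.\<close>

lemma several_husbands_other:
  assumes "card (stable_husbands n1 n2 P w) > 1"
  obtains M b where "stable n1 n2 P M" "b \<in> {1..n1}" "M b = w" "opt n1 n2 P b \<noteq> w"
proof -
  obtain b c where bc: "b \<in> stable_husbands n1 n2 P w" "c \<in> stable_husbands n1 n2 P w" "b \<noteq> c"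
    using assms by (metis One_nat_def card_le_Suc0_iff_eq card.infinite not_less not_less_zero)
  then have "b \<in> {1..n1}" "c \<in> {1..n1}" unfolding stable_husbands_def by auto
  then have "opt n1 n2 P b \<noteq> w \<or> opt n1 n2 P c \<noteq> w"
    using inj_on_opt bc(3) by (auto dest: inj_onD)
  then show ?thesis using bc that unfolding stable_husbands_def by blast
qed

lemma several_husbands_matched:
  assumes "card (stable_husbands n1 n2 P w) > 1"
  shows "w \<in> opt n1 n2 P ` {1..n1}"
  using several_husbands_other[OF assms] matched_women_unique by (metis imageI)

text \<open>
  In a second stable matching every man is at most as well off as after the restart, so none of
  them is driven to an unmatched woman.
\<close>

lemma restart_several_husbands:
  assumes "card (stable_husbands n1 n2 P w) > 1"
    and a: "a \<in> {1..n1}" "restart n1 n2 w P a \<in> targets n1 n2 w P"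
  shows "restart n1 n2 w P a = w"
proof (rule ccontr)
  assume ne: "restart n1 n2 w P a \<noteq> w"
  obtain M b where M: "stable n1 n2 P M" and b: "b \<in> {1..n1}" "M b = w" "opt n1 n2 P b \<noteq> w"
    using several_husbands_other[OF assms(1)] .
  \<comment> \<open>No pair of \<open>M\<close> is excluded: only \<open>b\<close> has
    \<open>w\<close> in \<open>M\<close>, and he ranks her strictly below his partner in
    \<open>opt\<close>.\<close>
  have "(m, M m) \<notin> suitors n1 n2 w P" if m: "m \<in> {1..n1}" for m
  proof
    assume "(m, M m) \<in> suitors n1 n2 w P"
    then have *: "M m = w" "fst P m w \<le> fst P m (opt n1 n2 P m)" by (auto simp: suitors_def)
    then have "m = b" using stable_inj[OF M] m b by (auto dest: inj_onD)
    have "fst P m (opt n1 n2 P m) = fst P m w" using opt_best[OF M m] * by simp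
    then show False using inj_men[OF m] b \<open>m = b\<close> by (simp add: inj_eq)
  qed
  from stable_not_rejected[OF M this]
  have "fst P a (restart n1 n2 w P a) \<le> fst P a (M a)"
    unfolding restart_def
    using a restart_ex_unrejected[OF several_husbands_matched[OF assms(1)]]
    by (intro assigned_le stable_in[OF M]) blast+
  \<comment> \<open>By the rural hospitals theorem this target is unmatched in \<open>M\<close>
    too.\<close>
  moreover have "restart n1 n2 w P a \<in> {1..n2}" "restart n1 n2 w P a \<notin> M ` {1..n1}"
    using a(2) ne matched_women_unique[OF M] unfolding targets_def by auto
  then have "fst P a (M a) < fst P a (restart n1 n2 w P a)"
    by (rule unmatched_worse[OF M a(1)])
  ultimately show False by simp
qed

end

subsection \<open>Exchangeability\<close>

locale redirected = market +
  fixes w t :: nat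
  assumes matched: "w \<in> opt n1 n2 P ` {1..n1}" and target: "t \<in> targets n1 n2 w P"
begin

abbreviation "Q \<equiv> redirect n1 n2 w t P"
abbreviation "s \<equiv> exch n1 n2 w t P"

lemma w_in: "w \<in> {1..n2}"
  using matched opt_in by blast

lemma t_in: "t \<in> {1..n2}"
  using target targets_subset w_in by blast

lemma fst_Q: "fst Q m v = fst P m (s m v)"
  by (simp add: redirect_def)

lemma snd_Q: "snd Q = snd P"
  by (simp add: redirect_def)

lemma s_s: "s m (s m v) = v"
  by (simp add: exch_def)

lemma s_in: "v \<in> {1..n2} \<Longrightarrow> s m v \<in> {1..n2}"
  using w_in t_in by (auto simp: exch_def Transposition.transpose_def)

lemma s_other: "v \<noteq> w \<Longrightarrow> v \<noteq> t \<Longrightarrow> s m v = v"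
  by (auto simp: exch_def Transposition.transpose_def)

lemma s_permutes: "s m permutes {1..n2}"
  unfolding exch_def using w_in t_in by (auto intro: permutes_swap_id permutes_id)

lemma Q_profile: "Q \<in> profiles n1 n2"
proof -
  have "fst P m \<circ> s m permutes {1..n2}" if "m \<in> {1..n1}" for m
    using profile that s_permutes
    by (intro permutes_compose) (auto simp: profiles_def PiE_dflt_def)
  then show ?thesis
    using profile unfolding profiles_def redirect_def PiE_dflt_def
    by (auto simp: exch_def)
qed

sublocale Q: market n1 n2 Q
  using Q_profile less by unfold_locales

text \<open>If \<open>m\<close> exchanges at all, both \<open>w\<close> and \<open>t\<close> lie
  below his partner.\<close>

lemma s_upper:
  assumes "m \<in> {1..n1}" "fst P m v \<le> fst P m (opt n1 n2 P m)"
  shows "s m v = v"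
proof (cases "fst P m (opt n1 n2 P m) < fst P m w")
  case True
  then show ?thesis
    using target_worse[OF assms(1) target] assms s_other by (metis not_less)
qed (simp add: exch_def)

text \<open>The exchange fixes the upper part of the list and, being an involution, moves no other
  woman into it.\<close>

lemma fst_Q_upper:
  assumes "m \<in> {1..n1}" "fst P m v \<le> fst P m (opt n1 n2 P m)"
  shows "fst Q m v' < fst Q m v \<longleftrightarrow> fst P m v' < fst P m v"
proof
  assume "fst Q m v' < fst Q m v"
  then have less: "fst P m (s m v') < fst P m v"
    unfolding fst_Q s_upper[OF assms] .
  then have "s m (s m v') = s m v'"
    using assms by (intro s_upper) auto
  then show "fst P m v' < fst P m v" using less by (simp add: s_s)
next
  assume "fst P m v' < fst P m v"
  then show "fst Q m v' < fst Q m v"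
    using s_upper[of m v'] assms unfolding fst_Q s_upper[OF assms] by simp
qed

text \<open>Proposals of the first run stop at the partners, and down to there the lists are
  unchanged.\<close>

lemma rejected_redirect_empty:
  "rejected n1 n2 P {} {} m v \<Longrightarrow> rejected n1 n2 Q {} {} m v"
proof (induction rule: rejected.induct)
  case (suitor a v m)
  have "\<not> fst P a (opt n1 n2 P a) < fst P a v"
    using suitor.hyps opt_in opt_not_rejected by blast
  then show ?case
    using suitor fst_Q_upper[of a v] snd_Q by (intro rejected.suitor[of n2 Q a v]) auto
qed simp

text \<open>Whether a pair blocks depends, on the side of the men, only on who is ranked above the
  partner.\<close>

lemma stable_redirect: "stable n1 n2 Q (opt n1 n2 P)"
proof -
  have "blocking_pair n1 n2 Q (opt n1 n2 P) m v \<longleftrightarrow> blocking_pair n1 n2 P (opt n1 n2 P) m v" for m v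
    unfolding blocking_pair_def snd_Q using fst_Q_upper[OF _ order_refl] by blast
  then show ?thesis using opt_stable by (simp add: stable_def)
qed

lemma opt_redirect:
  assumes m: "m \<in> {1..n1}"
  shows "opt n1 n2 Q m = opt n1 n2 P m"
  unfolding opt_def[of _ _ Q]
proof (rule Q.assigned_eqI[OF m])
  show "opt n1 n2 P m \<in> {1..n2}" by (rule opt_in[OF m])
  \<comment> \<open>No man is rejected by his partner in a matching that is stable for
    \<open>Q\<close>.\<close>
  show "\<not> rejected n1 n2 Q {} {} m (opt n1 n2 P m)"
    using Q.stable_not_rejected[OF stable_redirect _ _ m, of "{}" "{}"] by blast
  show "rejected n1 n2 Q {} {} m v'"
    if "v' \<in> {1..n2}" "fst Q m v' < fst Q m (opt n1 n2 P m)" for v'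
    using that fst_Q_upper[OF m order_refl] opt_better_rejected[OF m]
    by (intro rejected_redirect_empty) blast
qed

lemma image_opt_redirect: "opt n1 n2 Q ` {1..n1} = opt n1 n2 P ` {1..n1}"
  by (rule image_cong[OF refl opt_redirect])

lemma targets_redirect: "targets n1 n2 w Q = targets n1 n2 w P"
  unfolding targets_def image_opt_redirect ..

text \<open>If \<open>m\<close> exchanges, \<open>w\<close> takes the place of \<open>t\<close>,
  still below his partner. So the same men exchange in \<open>Q\<close>, and redirecting twice
  restores \<open>P\<close>.\<close>

lemma exch_cond_redirect:
  assumes "m \<in> {1..n1}"
  shows "fst Q m (opt n1 n2 Q m) < fst Q m w \<longleftrightarrow> fst P m (opt n1 n2 P m) < fst P m w"
proof (cases "fst P m (opt n1 n2 P m) < fst P m w")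
  case True
  then have "s m w = t" using assms by (simp add: exch_def)
  then show ?thesis
    using True target_worse[OF assms target True] s_upper[OF assms order_refl]
    by (simp add: fst_Q opt_redirect[OF assms])
next
  case False
  then show ?thesis using assms by (simp add: fst_Q opt_redirect[OF assms] exch_def)
qed

lemma exch_redirect: "exch n1 n2 w t Q = s"
proof
  fix m
  show "exch n1 n2 w t Q m = s m"
    unfolding exch_def using exch_cond_redirect[of m] by (cases "m \<in> {1..n1}") (simp_all only: simp_thms)
qed

lemma suitors_redirect: "suitors n1 n2 w Q = suitors n1 n2 w P"
proof -
  have "{m \<in> {1..n1}. \<not> fst Q m (opt n1 n2 Q m) < fst Q m w} =
      {m \<in> {1..n1}. \<not> fst P m (opt n1 n2 P m) < fst P m w}"
    using exch_cond_redirect by blast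
  then show ?thesis unfolding suitors_def not_less by simp
qed

lemma redirect_redirect: "redirect n1 n2 w t Q = P"
proof -
  have "(\<lambda>m. fst Q m \<circ> s m) = fst P"
    by (intro ext) (simp add: fst_Q s_s)
  then show ?thesis
    unfolding redirect_def[of _ _ _ _ Q] exch_redirect snd_Q by simp
qed

lemma matched_redirect: "w \<in> opt n1 n2 Q ` {1..n1}"
  unfolding image_opt_redirect by (rule matched)

lemma redirected_redirect: "redirected n1 n2 Q w t"
  using matched_redirect target unfolding targets_redirect[symmetric] by unfold_locales

text \<open>The exchange carries the restart over: men with an excluded pair do not exchange, and in
  the rule \<open>suitor\<close> the rejecting woman is not a target, so the exchange fixes
  her.\<close>

lemma rejected_redirect:
  assumes "rejected n1 n2 P (suitors n1 n2 w P) (targets n1 n2 w P) m v"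
  shows "rejected n1 n2 Q (suitors n1 n2 w Q) (targets n1 n2 w Q) m (s m v)"
  using assms
proof (induction rule: rejected.induct)
  case (excluded m v)
  then show ?case
    unfolding suitors_redirect by (intro rejected.excluded) (auto simp: suitors_def exch_def)
next
  case (suitor a v m)
  have v: "v \<noteq> w" "v \<noteq> t"
    using suitor.hyps target by (auto simp: targets_def)
  have "rejected n1 n2 Q (suitors n1 n2 w Q) (targets n1 n2 w Q) a v'"
    if "v' \<in> {1..n2}" "fst Q a v' < fst Q a v" for v'
    using suitor.IH[of "s a v'"] that s_in s_s s_other[OF v] by (simp add: fst_Q)
  then show ?case
    using suitor.hyps unfolding s_other[OF v]
    by (intro rejected.suitor[of n2 Q a v]) (auto simp: snd_Q targets_redirect)
qed

text \<open>The converse is \<open>rejected_redirect\<close> for \<open>Q\<close>, which redirects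
  back to \<open>P\<close>.\<close>

lemma rejected_redirect_iff:
  "rejected n1 n2 Q (suitors n1 n2 w Q) (targets n1 n2 w Q) m (s m v) \<longleftrightarrow>
   rejected n1 n2 P (suitors n1 n2 w P) (targets n1 n2 w P) m v"
  using rejected_redirect redirected.rejected_redirect[OF redirected_redirect, of m "s m v"]
  unfolding redirect_redirect exch_redirect s_s by blast

lemma restart_redirect:
  assumes "a \<in> {1..n1}"
  shows "restart n1 n2 w Q a = s a (restart n1 n2 w P a)"
  unfolding restart_def[of _ _ _ Q]
proof (rule Q.assigned_eqI)
  note ex = restart_ex_unrejected[OF matched, of a]
  show "s a (restart n1 n2 w P a) \<in> {1..n2}"
    by (intro s_in restart_in matched)
  show "\<not> rejected n1 n2 Q (suitors n1 n2 w Q) (targets n1 n2 w Q) a (s a (restart n1 n2 w P a))"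
    unfolding rejected_redirect_iff restart_def by (rule assigned_not_rejected[OF ex])
  fix v' assume v': "v' \<in> {1..n2}" "fst Q a v' < fst Q a (s a (restart n1 n2 w P a))"
  then have "rejected n1 n2 P (suitors n1 n2 w P) (targets n1 n2 w P) a (s a v')"
    unfolding fst_Q s_s restart_def by (intro assigned_better_rejected[OF ex] s_in)
  then show "rejected n1 n2 Q (suitors n1 n2 w Q) (targets n1 n2 w Q) a v'"
    using rejected_redirect_iff[of a "s a v'"] s_s by simp
qed (rule assms)

text \<open>This recovers \<open>t\<close> from the redirected profile. In \<open>P\<close> the
  restart reaches no target but \<open>w\<close>, and a man who reaches her is not an earlier
  suitor, so he exchanges her for \<open>t\<close>.\<close>

lemma restart_redirect_eq:
  assumes "card (stable_husbands n1 n2 P w) > 1"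
    and a: "a \<in> {1..n1}" "restart n1 n2 w Q a \<in> targets n1 n2 w Q"
  shows "restart n1 n2 w Q a = t"
proof -
  have "w \<in> targets n1 n2 w P" by (simp add: targets_def)
  have "s a (restart n1 n2 w Q a) \<in> targets n1 n2 w P"
    using a target \<open>w \<in> _\<close> unfolding targets_redirect
    by (auto simp: exch_def Transposition.transpose_def)
  then have "restart n1 n2 w P a \<in> targets n1 n2 w P"
    using a by (simp add: restart_redirect s_s)
  then have w: "restart n1 n2 w P a = w"
    by (rule restart_several_husbands[OF assms(1) a(1)])
  have "\<not> rejected n1 n2 P (suitors n1 n2 w P) (targets n1 n2 w P) a w"
    using assigned_not_rejected[OF restart_ex_unrejected[OF matched], of a] w
    by (simp add: restart_def)
  then have "(a, w) \<notin> suitors n1 n2 w P"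
    using rejected.excluded by blast
  then have "s a w = t"
    using a by (auto simp: suitors_def exch_def not_le)
  then show ?thesis using w restart_redirect[OF a(1)] by simp
qed

end

section \<open>Counting profiles\<close>

lemma finite_profiles: "finite (profiles n1 n2)"
  unfolding profiles_def by (intro finite_cartesian_product finite_PiE_dflt finite_permutations) auto

lemma profiles_nonempty: "profiles n1 n2 \<noteq> {}"
proof -
  have "(\<lambda>m. id, \<lambda>w. id) \<in> profiles n1 n2"
    by (simp add: profiles_def PiE_dflt_def permutes_id)
  then show ?thesis by blast
qed

text \<open>Redirecting is injective on pairs of such a profile and a target: the target reached by
  the restart reveals \<open>t\<close>, and redirecting once more gives back the profile.\<close>

lemma card_several_husbands:
  assumes "n1 < n2"
  shows "(n2 - n1 + 1) * card (several_husbands n1 n2 w) \<le> card (profiles n1 n2)"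
proof -
  let ?B = "several_husbands n1 n2 w"
  let ?S = "SIGMA P:?B. targets n1 n2 w P"
  let ?f = "\<lambda>(P, t). redirect n1 n2 w t P"
  have redirected: "redirected n1 n2 P w t" and market: "market n1 n2 P"
    and several: "card (stable_husbands n1 n2 P w) > 1"
    if "(P, t) \<in> ?S" for P t
  proof -
    show market: "market n1 n2 P" and several: "card (stable_husbands n1 n2 P w) > 1"
      using that assms by (auto simp: several_husbands_def market_def)
    show "redirected n1 n2 P w t"
      using market market.several_husbands_matched[OF market several] that
      by (simp add: redirected_def redirected_axioms_def)
  qed
  have "inj_on ?f ?S"
  proof (rule inj_onI, clarify)
    fix P t P' t'
    assume P: "P \<in> ?B" "t \<in> targets n1 n2 w P" and P': "P' \<in> ?B" "t' \<in> targets n1 n2 w P'"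
      and eq: "redirect n1 n2 w t P = redirect n1 n2 w t' P'"
    interpret P: redirected n1 n2 P w t using redirected P by blast
    interpret P': redirected n1 n2 P' w t' using redirected P' by blast
    obtain a where a: "a \<in> {1..n1}" "restart n1 n2 w P.Q a \<in> targets n1 n2 w P.Q"
      using P.Q.restart_reaches_target[OF P.matched_redirect] by blast
    have "t = t'"
      using P.restart_redirect_eq[OF several a] P'.restart_redirect_eq[OF several, of t' a] P P' a
      unfolding eq by blast
    then show "P = P' \<and> t = t'"
      using P.redirect_redirect P'.redirect_redirect eq by metis
  qed
  moreover have "?f ` ?S \<subseteq> profiles n1 n2"
    using redirected.Q_profile[OF redirected] by auto
  ultimately have "card ?S \<le> card (profiles n1 n2)"
    by (intro card_inj_on_le finite_profiles)
  moreover have "finite ?B"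
    using finite_profiles by (simp add: several_husbands_def)
  then have "card ?S = (\<Sum>P\<in>?B. card (targets n1 n2 w P))"
    by (intro card_SigmaI) (auto simp: targets_def)
  moreover have "card (targets n1 n2 w P) = n2 - n1 + 1" if "P \<in> ?B" for P
  proof -
    \<comment> \<open>\<open>w\<close> is always a target, so \<open>(P, w)\<close> is a pair to
      which \<open>market\<close> applies.\<close>
    interpret market n1 n2 P using market[of P w] that by (simp add: targets_def)
    show ?thesis using that by (intro card_targets several_husbands_matched)
      (simp add: several_husbands_def)
  qed
  ultimately show ?thesis by (simp add: mult.commute)
qed

text \<open>Independent uniform choices are uniform on the product, which turns probabilities into
  counts.\<close>

lemma random_profile_uniform: "random_profile n1 n2 = pmf_of_set (profiles n1 n2)"
proof (rule pmf_eqI)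
  fix P :: profile
  have Pi: "pmf (Pi_pmf A d (\<lambda>_. pmf_of_set B)) f =
      indicator (PiE_dflt A d (\<lambda>_. B)) f / card (PiE_dflt A d (\<lambda>_. B))"
    if "finite A" "finite B" "B \<noteq> {}" for A :: "nat set" and B :: "'b set" and d f
  proof -
    have "card (PiE_dflt A d (\<lambda>_. B)) = card B ^ card A"
      using that by (simp add: card_PiE_dflt)
    then show ?thesis
      using that by (auto simp: pmf_Pi PiE_dflt_def indicator_def power_divide)
  qed
  have ne: "\<exists>p. p permutes S" for S :: "nat set"
    using permutes_id by blast
  have "pmf (random_profile n1 n2) P = indicator (profiles n1 n2) P / card (profiles n1 n2)"
    unfolding random_profile_def pmf_pair[of _ _ "fst P" "snd P", unfolded prod.collapse] profiles_def
    by (subst (1 2) Pi)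
      (auto intro!: finite_permutations simp: ne indicator_def mem_Times_iff card_cartesian_product)
  then show "pmf (random_profile n1 n2) P = pmf (pmf_of_set (profiles n1 n2)) P"
    by (simp add: pmf_of_set finite_profiles profiles_nonempty)
qed

lemma prob_several_husbands:
  assumes "n1 < n2"
  shows "measure_pmf.prob (random_profile n1 n2) (several_husbands n1 n2 w) \<le> 1 / (real n2 - n1 + 1)"
proof -
  have eq: "measure_pmf.prob (random_profile n1 n2) (several_husbands n1 n2 w) =
      card (several_husbands n1 n2 w) / card (profiles n1 n2)"
    unfolding random_profile_uniform
    by (subst measure_pmf_of_set)
      (auto simp: finite_profiles profiles_nonempty several_husbands_def intro!: arg_cong[of _ _ card])
  have "real ((n2 - n1 + 1) * card (several_husbands n1 n2 w)) \<le> card (profiles n1 n2)"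
    using card_several_husbands[OF assms] of_nat_mono by blast
  then have "(real n2 - n1 + 1) * card (several_husbands n1 n2 w) \<le> card (profiles n1 n2)"
    unfolding of_nat_mult using assms by (simp add: of_nat_diff add.commute)
  moreover have "b / c \<le> 1 / k" if "k * b \<le> c" "c > 0" "k > 0" for b c k :: real
    using that by (simp add: field_simps)
  moreover have "card (profiles n1 n2) > 0"
    by (simp add: card_gt_0_iff finite_profiles profiles_nonempty)
  ultimately show ?thesis
    unfolding eq using assms by simp
qed

subsection \<open>The numbers of men and women with several stable partners\<close>

definition num_women :: "nat \<Rightarrow> nat \<Rightarrow> profile \<Rightarrow> nat" where
  "num_women n1 n2 P = card {w \<in> {1..n2}. card (stable_husbands n1 n2 P w) > 1}"

lemma set_pmf_random_profile: "set_pmf (random_profile n1 n2) = profiles n1 n2"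
  by (simp add: random_profile_uniform finite_profiles profiles_nonempty)

lemma expectation_num_women:
  assumes "n1 < n2"
  shows "measure_pmf.expectation (random_profile n1 n2) (num_women n1 n2) \<le> n2 / (real n2 - n1 + 1)"
proof -
  let ?p = "random_profile n1 n2"
  have "measure_pmf.expectation ?p (num_women n1 n2) =
      measure_pmf.expectation ?p (\<lambda>P. \<Sum>w\<in>{1..n2}. indicator (several_husbands n1 n2 w) P)"
  proof (intro integral_cong_AE)
    show "AE P in ?p. real (num_women n1 n2 P) =
        (\<Sum>w\<in>{1..n2}. indicator (several_husbands n1 n2 w) P)"
      by (auto simp: AE_measure_pmf_iff set_pmf_random_profile num_women_def several_husbands_def
          indicator_def sum.If_cases Int_def)
  qed auto
  also have "\<dots> = (\<Sum>w\<in>{1..n2}. measure_pmf.prob ?p (several_husbands n1 n2 w))"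
    by (subst Bochner_Integration.integral_sum)
      (auto intro!: integrable_measure_pmf_finite simp: set_pmf_random_profile finite_profiles)
  also have "\<dots> \<le> (\<Sum>w\<in>{1..n2}. 1 / (real n2 - n1 + 1))"
    using prob_several_husbands[OF assms] by (intro sum_mono)
  finally show ?thesis by simp
qed

lemma prob_num_women:
  assumes "n1 < n2" "c > 0"
  shows "measure_pmf.prob (random_profile n1 n2) {P. real (num_women n1 n2 P) \<ge> c} \<le>
    n2 / (real n2 - n1 + 1) / c"
proof -
  have "measure_pmf.prob (random_profile n1 n2) {P. real (num_women n1 n2 P) \<ge> c} \<le>
      measure_pmf.expectation (random_profile n1 n2) (num_women n1 n2) / c"
    using integral_Markov_inequality_measure[of "random_profile n1 n2" "num_women n1 n2" "{}" c] assms
    by (simp add: integrable_measure_pmf_finite set_pmf_random_profile finite_profiles)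
  also have "\<dots> \<le> n2 / (real n2 - n1 + 1) / c"
    using expectation_num_women assms by (intro divide_right_mono) auto
  finally show ?thesis .
qed

text \<open>In a stable matching that gives \<open>m\<close> another wife,
  \<open>opt n1 n2 P m\<close> stays matched by the rural hospitals theorem, hence to a second
  husband. So the injective \<open>opt\<close> sends these men to such women.\<close>

lemma num_men_le_num_women:
  assumes "P \<in> profiles n1 n2" "n1 < n2"
  shows "card {m \<in> {1..n1}. card (stable_wives n1 n2 P m) > 1} \<le> num_women n1 n2 P"
proof -
  interpret market n1 n2 P using assms by unfold_locales
  have "card (stable_husbands n1 n2 P (opt n1 n2 P m)) > 1"
    if m: "m \<in> {1..n1}" "card (stable_wives n1 n2 P m) > 1" for m
  proof -
    obtain v v' where "v \<in> stable_wives n1 n2 P m" "v' \<in> stable_wives n1 n2 P m" "v \<noteq> v'"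
      using m(2) by (metis One_nat_def card_le_Suc0_iff_eq card.infinite not_less not_less_zero)
    then obtain u where "u \<in> stable_wives n1 n2 P m" "u \<noteq> opt n1 n2 P m"
      by metis
    then obtain M where M: "stable n1 n2 P M" "M m \<noteq> opt n1 n2 P m"
      by (auto simp: stable_wives_def)
    have "opt n1 n2 P m \<in> M ` {1..n1}"
      using matched_women_unique[OF M(1)] m by blast
    then obtain b where b: "b \<in> {1..n1}" "M b = opt n1 n2 P m" by auto
    have "{m, b} \<subseteq> stable_husbands n1 n2 P (opt n1 n2 P m)"
      using m(1) b M(1) opt_stable by (auto simp: stable_husbands_def)
    moreover have "finite (stable_husbands n1 n2 P (opt n1 n2 P m))"
      by (simp add: stable_husbands_def)
    ultimately have "card {m, b} \<le> card (stable_husbands n1 n2 P (opt n1 n2 P m))"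
      by (metis card_mono)
    moreover have "m \<noteq> b" using b M by blast
    ultimately show ?thesis by simp
  qed
  then have "opt n1 n2 P ` {m \<in> {1..n1}. card (stable_wives n1 n2 P m) > 1} \<subseteq>
      {w \<in> {1..n2}. card (stable_husbands n1 n2 P w) > 1}"
    using opt_in by blast
  then show ?thesis
    unfolding num_women_def
    by (intro card_inj_on_le[of "opt n1 n2 P"] inj_on_subset[OF inj_on_opt]) auto
qed

section \<open>Tail bounds and the limit\<close>

lemma prob_women_fraction:
  assumes "n1 < n2" "\<epsilon> > 0"
  shows "measure_pmf.prob (random_profile n1 n2) {P. \<bar>women_fraction n1 n2 P - 0\<bar> > \<epsilon>} \<le>
    1 / (real n2 - n1 + 1) / \<epsilon>"
proof -
  have "measure_pmf.prob (random_profile n1 n2) {P. \<bar>women_fraction n1 n2 P - 0\<bar> > \<epsilon>} \<le>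
      measure_pmf.prob (random_profile n1 n2) {P. real (num_women n1 n2 P) \<ge> \<epsilon> * n2}"
    using assms by (intro measure_pmf.finite_measure_mono)
      (auto simp: women_fraction_def num_women_def field_simps)
  also have "\<dots> \<le> n2 / (real n2 - n1 + 1) / (\<epsilon> * n2)"
    using assms by (intro prob_num_women) auto
  also have "\<dots> = 1 / (real n2 - n1 + 1) / \<epsilon>"
    using assms by simp
  finally show ?thesis .
qed

lemma prob_men_fraction:
  assumes "n1 < n2" "n1 > 0" "\<epsilon> > 0"
  shows "measure_pmf.prob (random_profile n1 n2) {P. \<bar>men_fraction n1 n2 P - 0\<bar> > \<epsilon>} \<le>
    (1 / n1 + 1 / (real n2 - n1 + 1)) / \<epsilon>"
proof -
  have "\<epsilon> * n1 \<le> num_women n1 n2 P"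
    if "P \<in> profiles n1 n2" "\<bar>men_fraction n1 n2 P - 0\<bar> > \<epsilon>" for P
  proof -
    have "\<epsilon> * n1 \<le> card {m \<in> {1..n1}. card (stable_wives n1 n2 P m) > 1}"
      using that assms by (simp add: men_fraction_def field_simps)
    then show ?thesis
      using num_men_le_num_women[OF that(1) assms(1)] by linarith
  qed
  then have "measure_pmf.prob (random_profile n1 n2) {P. \<bar>men_fraction n1 n2 P - 0\<bar> > \<epsilon>} \<le>
      measure_pmf.prob (random_profile n1 n2) {P. real (num_women n1 n2 P) \<ge> \<epsilon> * n1}"
    by (intro measure_pmf.finite_measure_mono_AE)
      (auto simp: AE_measure_pmf_iff set_pmf_random_profile)
  also have "\<dots> \<le> n2 / (real n2 - n1 + 1) / (\<epsilon> * n1)"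
    using assms by (intro prob_num_women) auto
  \<comment> \<open>Splitting \<open>n2\<close> into \<open>n1\<close> and the gap keeps the bound
    uniform in \<open>n2\<close>, however large \<open>n2 / n1\<close> is.\<close>
  also have "\<dots> \<le> (real n1 + (real n2 - n1 + 1)) / (real n2 - n1 + 1) / (\<epsilon> * n1)"
    using assms by (intro divide_right_mono) auto
  also have "\<dots> = (1 / n1 + 1 / (real n2 - n1 + 1)) / \<epsilon>"
  proof -
    have "(x + k) / k / (\<epsilon> * x) = (1 / x + 1 / k) / \<epsilon>" if "x > 0" "k > 0" for x k :: real
      using that assms(3) by (simp add: field_simps)
    from this[of "real n1" "real n2 - n1 + 1"] show ?thesis using assms by simp
  qed
  finally show ?thesis .
qed

theorem theorem1p6:
  fixes \<gamma> :: real and A :: "(nat \<times> nat) set"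
  assumes "\<gamma> < 1"
    and "A = {(n1, n2). n1 < n2 \<and>
           real n2 - real n1 \<ge> real n1 powr (1/2) * ln (real n1) powr (- \<gamma>)}"
  shows "tendsto_in_prob (\<lambda>(n1, n2). random_profile n1 n2)
           (\<lambda>(n1, n2). men_fraction n1 n2) 0 (fst_at_top_within A) \<and>
         tendsto_in_prob (\<lambda>(n1, n2). random_profile n1 n2)
           (\<lambda>(n1, n2). women_fraction n1 n2) 0 (fst_at_top_within A)"
proof -
  let ?F = "fst_at_top_within A"
  \<comment> \<open>The lower bound on the gap at the extreme exponent \<open>\<gamma> = 1\<close>;
    it depends on \<open>n1\<close> only and still tends to infinity.\<close>
  define g where "g = (\<lambda>x::real. x powr (1/2) * ln x powr - 1)"
  have g: "filterlim (\<lambda>n. g (real n)) at_top at_top"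
    unfolding g_def by real_asymp
  have fst: "filterlim fst at_top ?F"
    unfolding fst_at_top_within_def filterlim_def
    by (meson filtermap_filtercomap filtermap_mono inf_le1 order_trans)
  have in_A: "eventually (\<lambda>x. fst x < snd x \<and> fst x > 0 \<and> g (real (fst x)) \<le> (real (snd x) - fst x + 1)) ?F"
    unfolding eventually_fst_at_top_within
  \<comment> \<open>Since \<open>exp 1 \<le> 3\<close>, the logarithm is at least \<open>1\<close>
    from here on, so lowering its exponent from \<open>-\<gamma>\<close> to \<open>-1\<close> does
    not increase the power.\<close>
  proof (intro exI[of _ 3] allI impI)
    fix n1 n2 :: nat assume n1: "n1 \<ge> 3" and "(n1, n2) \<in> A"
    then have n2: "n1 < n2" "real n1 powr (1/2) * ln (real n1) powr (- \<gamma>) \<le> real n2 - real n1"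
      using assms(2) by auto
    have "exp 1 \<le> real n1" using exp_le n1 by linarith
    then have "ln (real n1) \<ge> 1" using n1 by (subst ln_ge_iff) auto
    then have "ln (real n1) powr - 1 \<le> ln (real n1) powr (- \<gamma>)"
      using assms(1) by (intro powr_mono) auto
    then have "g (real n1) \<le> real n1 powr (1/2) * ln (real n1) powr (- \<gamma>)"
      unfolding g_def by (intro mult_left_mono) auto
    then show "fst (n1, n2) < snd (n1, n2) \<and> fst (n1, n2) > 0 \<and>
        g (real (fst (n1, n2))) \<le> real (snd (n1, n2)) - fst (n1, n2) + 1"
      using n1 n2 by (simp add: of_nat_diff)
  qed
  have gap: "filterlim (\<lambda>x. (real (snd x) - fst x + 1)) at_top ?F"
    using filterlim_compose[OF g fst] in_A
    by (elim filterlim_at_top_mono) (auto elim: eventually_mono)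
  have n1: "filterlim (\<lambda>x. real (fst x)) at_top ?F"
    by (rule filterlim_compose[OF filterlim_real_sequentially fst])
  have lim: "((\<lambda>x. 1 / (real (snd x) - fst x + 1)) \<longlongrightarrow> 0) ?F"
    "((\<lambda>x. 1 / real (fst x)) \<longlongrightarrow> 0) ?F"
    by (rule tendsto_divide_0[OF tendsto_const filterlim_at_top_imp_at_infinity], rule gap n1)+
  have bounds: "((\<lambda>x. 1 / (real (snd x) - fst x + 1) / \<epsilon>) \<longlongrightarrow> 0) ?F"
    "((\<lambda>x. (1 / real (fst x) + 1 / (real (snd x) - fst x + 1)) / \<epsilon>) \<longlongrightarrow> 0) ?F"
    if "\<epsilon> > 0" for \<epsilon> :: real
    using tendsto_divide[OF lim(1) tendsto_const, of \<epsilon>]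
      tendsto_divide[OF tendsto_add[OF lim(2,1)] tendsto_const, of \<epsilon>] that by simp_all
  show ?thesis
    unfolding tendsto_in_prob_def
  proof (intro conjI allI impI)
    fix \<epsilon> :: real assume \<epsilon>: "\<epsilon> > 0"
    show "((\<lambda>i. measure_pmf.prob (case i of (n1, n2) \<Rightarrow> random_profile n1 n2)
        {x. \<epsilon> < \<bar>(case i of (n1, n2) \<Rightarrow> men_fraction n1 n2) x - 0\<bar>}) \<longlongrightarrow> 0) ?F"
      using \<epsilon> in_A prob_men_fraction
      by (intro tendsto_sandwich[OF _ _ tendsto_const bounds(2)[OF \<epsilon>]])
        (auto elim!: eventually_mono simp: case_prod_beta)
    show "((\<lambda>i. measure_pmf.prob (case i of (n1, n2) \<Rightarrow> random_profile n1 n2)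
        {x. \<epsilon> < \<bar>(case i of (n1, n2) \<Rightarrow> women_fraction n1 n2) x - 0\<bar>}) \<longlongrightarrow> 0) ?F"
      using \<epsilon> in_A prob_women_fraction
      by (intro tendsto_sandwich[OF _ _ tendsto_const bounds(1)[OF \<epsilon>]])
        (auto elim!: eventually_mono simp: case_prod_beta)
  qed
qed

end
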